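(* Let $f\in\mathcal{SR}(\Omega)$, where either - $\Omega\subseteq Q_{\mathbb{DH}}$ is a slice domain and ${}^{\pi}\!f\not\equiv0$; or - $\Omega\subseteq Q_{\mathbb{DH}}$ is a product domain and $N({}^{\pi}\!f)\not\equiv0$. Then the zero set $V(f)$ is a union of singletons $\{y\}$, tangent planes $T_{y_1}$ or "spheres" $\mathbb{S}_y$, each isolated from the rest of $V(f)$. If, moreover, $f=P_{|Q_{\mathbb{DH}}}$ for some polynomial $P(t)\in\mathbb{DH}[t]$, then the union is finite.
   Context: $\mathbb{H}$ is the algebra of quaternions, with conjugation $q\mapsto q^c$; $\mathrm{Im}(\mathbb{H})$ is the space of purely imaginary quaternions; $p\perp q$ means $pq^c+qp^c=0$. The dual quaternions are $\mathbb{DH}=\mathbb{H}+\epsilon\mathbb{H}\cong\mathbb{R}^8$, with elements $h=h_1+\epsilon h_2$, componentwise addition and product $hh'=h_1h'_1+\epsilon(h_1h'_2+h_2h'_1)$; $\pi(h)=h_1$ is the primal part (a subscript $1$ denotes the primal part). Put $h^c=h_1^c+\epsilon h_2^c$, $t(h)=h+h^c$, $n(h)=hh^c$. For $A=\mathbb{H}$ or $\mathbb{DH}$ let $\mathbb{S}_A=\{J\in A: t(J)=0,\ n(J)=1\}$. Let $Q_{\mathbb{DH}}=\{\alpha+\beta J:\alpha,\beta\in\mathbb{R},\ J\in\mathbb{S}_{\mathbb{DH}}\}$ (with the Euclidean relative topology). For $x=\alpha+\beta J\in Q_{\mathbb{DH}}$ put $\mathbb{S}_x=\alpha+\beta\,\mathbb{S}_{\mathbb{DH}}$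 and, if $x\notin\mathbb{R}$, $T_{x_1}=\{x_1+\epsilon\gamma:\gamma\in\mathrm{Im}(\mathbb{H}),\ \gamma\perp\mathrm{Im}(x_1)\}\subset\mathbb{S}_x$. For $D\subseteq\mathbb{C}$ invariant under complex conjugation, $\Omega_D=\{\alpha+\beta J:\alpha,\beta\in\mathbb{R},\ \alpha+i\beta\in D,\ J\in\mathbb{S}_{\mathbb{DH}}\}$. $\Omega=\Omega_D$ is a slice domain if $D$ is open, connected, intersects $\mathbb{R}$ and is preserved by complex conjugation; it is a product domain if $D$ is open, does not intersect $\mathbb{R}$ and has two connected components swapped by complex conjugation. For $A=\mathbb{H}$ or $\mathbb{DH}$, let $A_{\mathbb{C}}=A\otimes_{\mathbb{R}}\mathbb{C}=\{a+\iota b: a,b\in A\}$, $\iota^2=-1$, $\iota$ central, $(a+\iota b)^c=a^c+\iota b^c$. A stem function is $F=F_1+\iota F_2:D\to A_{\mathbb{C}}$ with $F_1(\bar z)=F_1(z)$, $F_2(\bar z)=-F_2(z)$; it induces the slice function $f=\mathcal{I}(F)$, $f(\alpha+\beta J)=F_1(\alpha+i\beta)+JF_2(\alpha+i\beta)$ for $J\in\mathbb{S}_A$ and $\alpha+i\beta\in D$. Its normal function is $N(f)=\mathcal{I}(FF^c)$, with $F^c(z)=F(z)^c$ and pointwise product. For $D$ open, $f=\mathcal{I}(F)$ is slice regular if $F$ is of class $C^1$ and $\frac{\partial F}{\partial\alpha}+\iota\frac{\partial F}{\partial\beta}=0$; $\mathcal{SR}(\Omega)$ is the set of slice regular functions $\Omega\to\mathbb{DH}$.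 The primal part of $f=\mathcal{I}(F_1+\iota F_2):\Omega\to\mathbb{DH}$ is the quaternionic slice function ${}^{\pi}\!f:\Omega\cap\mathbb{H}\to\mathbb{H}$ induced by $\pi\circ F_1+\iota\,\pi\circ F_2$. $V(f)=\{x\in\Omega: f(x)=0\}$. $\mathbb{DH}[t]$ is the algebra of polynomials $P(t)=\sum t^na_n$, $a_n\in\mathbb{DH}$, evaluated by $P(x)=\sum x^na_n$; $P_{|Q_{\mathbb{DH}}}$ is a slice regular function on $Q_{\mathbb{DH}}=\Omega_{\mathbb{C}}$. *)

theory Defs
  imports "HOL-Analysis.Analysis" "HOL-Computational_Algebra.Polynomial"
begin

section \<open>Real algebras with conjugation\<close>

class conjugation_algebra = real_algebra_1 +
  fixes conjugate :: "'a \<Rightarrow> 'a"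
  assumes conjugate_conjugate [simp]: "conjugate (conjugate x) = x"
    and conjugate_add: "conjugate (x + y) = conjugate x + conjugate y"
    and conjugate_scaleR: "conjugate (r *\<^sub>R x) = r *\<^sub>R conjugate x"
    and conjugate_mult: "conjugate (x * y) = conjugate y * conjugate x"

definition trace_conj :: "'a::conjugation_algebra \<Rightarrow> 'a"
  where "trace_conj h = h + conjugate h"

definition norm_conj :: "'a::conjugation_algebra \<Rightarrow> 'a"
  where "norm_conj h = h * conjugate h"

definition imag_units :: "'a::conjugation_algebra set"
  where "imag_units = {J. trace_conj J = 0 \<and> norm_conj J = 1}"

section \<open>Quaternions\<close>

datatype quat = Quat (Re_q: real) (Im_i: real) (Im_j: real) (Im_k: real)

lemma quat_eq_iff:
  "p = q \<longleftrightarrow> Re_q p = Re_q q \<and> Im_i p = Im_i q \<and> Im_j p = Im_j q \<and> Im_k p = Im_k q"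
  by (auto intro: quat.expand)

instantiation quat :: real_algebra_1
begin

definition "0 = Quat 0 0 0 0"
definition "1 = Quat 1 0 0 0"
definition "p + q = Quat (Re_q p + Re_q q) (Im_i p + Im_i q) (Im_j p + Im_j q) (Im_k p + Im_k q)"
definition "p - q = Quat (Re_q p - Re_q q) (Im_i p - Im_i q) (Im_j p - Im_j q) (Im_k p - Im_k q)"
definition "- q = Quat (- Re_q q) (- Im_i q) (- Im_j q) (- Im_k q)"
definition "r *\<^sub>R q = Quat (r * Re_q q) (r * Im_i q) (r * Im_j q) (r * Im_k q)"
definition "p * q = Quat
  (Re_q p * Re_q q - Im_i p * Im_i q - Im_j p * Im_j q - Im_k p * Im_k q)
  (Re_q p * Im_i q + Im_i p * Re_q q + Im_j p * Im_k q - Im_k p * Im_j q)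
  (Re_q p * Im_j q - Im_i p * Im_k q + Im_j p * Re_q q + Im_k p * Im_i q)
  (Re_q p * Im_k q + Im_i p * Im_j q - Im_j p * Im_i q + Im_k p * Re_q q)"

instance
  by standard
    (simp_all add: quat_eq_iff zero_quat_def one_quat_def plus_quat_def minus_quat_def
      uminus_quat_def scaleR_quat_def times_quat_def algebra_simps)

end

lemma quat_sel_simps [simp]:
  "Re_q 0 = 0" "Im_i 0 = 0" "Im_j 0 = 0" "Im_k 0 = 0"
  "Re_q 1 = 1" "Im_i 1 = 0" "Im_j 1 = 0" "Im_k 1 = 0"
  "Re_q (p + q) = Re_q p + Re_q q" "Im_i (p + q) = Im_i p + Im_i q"
  "Im_j (p + q) = Im_j p + Im_j q" "Im_k (p + q) = Im_k p + Im_k q"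
  "Re_q (p - q) = Re_q p - Re_q q" "Im_i (p - q) = Im_i p - Im_i q"
  "Im_j (p - q) = Im_j p - Im_j q" "Im_k (p - q) = Im_k p - Im_k q"
  "Re_q (- q) = - Re_q q" "Im_i (- q) = - Im_i q"
  "Im_j (- q) = - Im_j q" "Im_k (- q) = - Im_k q"
  "Re_q (r *\<^sub>R q) = r * Re_q q" "Im_i (r *\<^sub>R q) = r * Im_i q"
  "Im_j (r *\<^sub>R q) = r * Im_j q" "Im_k (r *\<^sub>R q) = r * Im_k q"
  "Re_q (p * q) = Re_q p * Re_q q - Im_i p * Im_i q - Im_j p * Im_j q - Im_k p * Im_k q"
  "Im_i (p * q) = Re_q p * Im_i q + Im_i p * Re_q q + Im_j p * Im_k q - Im_k p * Im_j q"
  "Im_j (p * q) = Re_q p * Im_j q - Im_i p * Im_k q + Im_j p * Re_q q + Im_k p * Im_i q"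
  "Im_k (p * q) = Re_q p * Im_k q + Im_i p * Im_j q - Im_j p * Im_i q + Im_k p * Re_q q"
  by (simp_all add: zero_quat_def one_quat_def plus_quat_def minus_quat_def
      uminus_quat_def scaleR_quat_def times_quat_def)

instantiation quat :: conjugation_algebra
begin

definition "conjugate q = Quat (Re_q q) (- Im_i q) (- Im_j q) (- Im_k q)"

instance
  by standard (simp_all add: quat_eq_iff conjugate_quat_def algebra_simps)

end

instantiation quat :: euclidean_space
begin

definition "inner p q = Re_q p * Re_q q + Im_i p * Im_i q + Im_j p * Im_j q + Im_k p * Im_k q"
definition "norm (q::quat) = sqrt (inner q q)"
definition "sgn (q::quat) = q /\<^sub>R norm q"
definition "dist (p::quat) q = norm (p - q)"
definition [code del]:
  "(uniformity :: (quat \<times> quat) filter) = (INF e\<in>{0 <..}. principal {(x, y). dist x y < e})"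
definition [code del]:
  "open (U :: quat set) \<longleftrightarrow> (\<forall>x\<in>U. eventually (\<lambda>(x', y). x' = x \<longrightarrow> y \<in> U) uniformity)"
definition "Basis = {Quat 1 0 0 0, Quat 0 1 0 0, Quat 0 0 1 0, Quat 0 0 0 1}"

instance
proof
  fix x y z :: quat and r :: real
  show "inner x y = inner y x"
    by (simp add: inner_quat_def algebra_simps)
  show "inner (x + y) z = inner x z + inner y z"
    by (simp add: inner_quat_def algebra_simps)
  show "inner (r *\<^sub>R x) y = r * inner x y"
    by (simp add: inner_quat_def algebra_simps)
  show "0 \<le> inner x x"
    by (simp add: inner_quat_def)
  show "inner x x = 0 \<longleftrightarrow> x = 0"
    by (simp add: inner_quat_def quat_eq_iff add_nonneg_eq_0_iff)
  show "(Basis :: quat set) \<noteq> {}" "finite (Basis :: quat set)"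
    by (simp_all add: Basis_quat_def)
  show "(\<forall>u\<in>Basis. inner x u = 0) \<longleftrightarrow> x = 0"
    unfolding Basis_quat_def ball_simps(5,7) inner_quat_def quat_eq_iff[of x 0] by simp
next
  fix u v :: quat
  assume "u \<in> Basis" "v \<in> Basis"
  then show "inner u v = (if u = v then 1 else 0)"
    unfolding Basis_quat_def inner_quat_def by (elim insertE emptyE) simp_all
qed (rule norm_quat_def sgn_quat_def dist_quat_def uniformity_quat_def open_quat_def)+

end

definition Im_H :: "quat set"
  where "Im_H = {q. Re_q q = 0}"

definition Im_part :: "quat \<Rightarrow> quat"
  where "Im_part q = Quat 0 (Im_i q) (Im_j q) (Im_k q)"

definition quat_perp :: "quat \<Rightarrow> quat \<Rightarrow> bool"
  where "quat_perp p q \<longleftrightarrow> p * conjugate q + q * conjugate p = 0"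

section \<open>Dual quaternions\<close>

text \<open>\<^term>\<open>Dual h1 h2\<close> is h1 + epsilon h2.\<close>

datatype dquat = Dual (primal: quat) (dual: quat)

lemma dquat_eq_iff: "h = k \<longleftrightarrow> primal h = primal k \<and> dual h = dual k"
  by (auto intro: dquat.expand)

instantiation dquat :: real_algebra_1
begin

definition "0 = Dual 0 0"
definition "1 = Dual 1 0"
definition "h + k = Dual (primal h + primal k) (dual h + dual k)"
definition "h - k = Dual (primal h - primal k) (dual h - dual k)"
definition "- h = Dual (- primal h) (- dual h)"
definition "r *\<^sub>R h = Dual (r *\<^sub>R primal h) (r *\<^sub>R dual h)"
definition "h * k = Dual (primal h * primal k) (primal h * dual k + dual h * primal k)"

instance
  by standard
    (simp_all add: dquat_eq_iff zero_dquat_def one_dquat_def plus_dquat_def minus_dquat_def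
      uminus_dquat_def scaleR_dquat_def times_dquat_def algebra_simps)

end

lemma dquat_sel_simps [simp]:
  "primal 0 = 0" "dual 0 = 0" "primal 1 = 1" "dual 1 = 0"
  "primal (h + k) = primal h + primal k" "dual (h + k) = dual h + dual k"
  "primal (h - k) = primal h - primal k" "dual (h - k) = dual h - dual k"
  "primal (- h) = - primal h" "dual (- h) = - dual h"
  "primal (r *\<^sub>R h) = r *\<^sub>R primal h" "dual (r *\<^sub>R h) = r *\<^sub>R dual h"
  "primal (h * k) = primal h * primal k" "dual (h * k) = primal h * dual k + dual h * primal k"
  by (simp_all add: zero_dquat_def one_dquat_def plus_dquat_def minus_dquat_def
      uminus_dquat_def scaleR_dquat_def times_dquat_def)

instantiation dquat :: conjugation_algebra
begin

definition "conjugate h = Dual (conjugate (primal h)) (conjugate (dual h))"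

instance
  by standard
    (simp_all add: dquat_eq_iff conjugate_dquat_def conjugate_add conjugate_scaleR
      conjugate_mult algebra_simps)

end

text \<open>Euclidean structure of R^8. The norm is not submultiplicative, so dual quaternions do
  not form an instance of \<^class>\<open>real_normed_algebra\<close>.\<close>

instantiation dquat :: euclidean_space
begin

definition "inner h k = inner (primal h) (primal k) + inner (dual h) (dual k)"
definition "norm (h::dquat) = sqrt (inner h h)"
definition "sgn (h::dquat) = h /\<^sub>R norm h"
definition "dist (h::dquat) k = norm (h - k)"
definition [code del]:
  "(uniformity :: (dquat \<times> dquat) filter) = (INF e\<in>{0 <..}. principal {(x, y). dist x y < e})"
definition [code del]:
  "open (U :: dquat set) \<longleftrightarrow> (\<forall>x\<in>U. eventually (\<lambda>(x', y). x' = x \<longrightarrow> y \<in> U) uniformity)"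
definition "Basis = (\<lambda>b. Dual b 0) ` Basis \<union> (\<lambda>b. Dual 0 b) ` Basis"

instance
proof
  fix x y z :: dquat and r :: real
  show "inner x y = inner y x"
    by (simp add: inner_dquat_def inner_commute)
  show "inner (x + y) z = inner x z + inner y z"
    by (simp add: inner_dquat_def inner_add_left)
  show "inner (r *\<^sub>R x) y = r * inner x y"
    by (simp add: inner_dquat_def algebra_simps)
  show "0 \<le> inner x x"
    by (simp add: inner_dquat_def)
  show "inner x x = 0 \<longleftrightarrow> x = 0"
    by (simp add: inner_dquat_def dquat_eq_iff add_nonneg_eq_0_iff)
  show "(Basis :: dquat set) \<noteq> {}" "finite (Basis :: dquat set)"
    by (simp_all add: Basis_dquat_def)
  show "(\<forall>u\<in>Basis. inner x u = 0) \<longleftrightarrow> x = 0"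
    by (simp add: Basis_dquat_def inner_dquat_def dquat_eq_iff ball_Un euclidean_all_zero_iff)
next
  fix u v :: dquat
  assume "u \<in> Basis" "v \<in> Basis"
  then show "inner u v = (if u = v then 1 else 0)"
    by (auto simp: Basis_dquat_def inner_dquat_def inner_Basis split: if_splits)
qed (rule norm_dquat_def sgn_dquat_def dist_dquat_def uniformity_dquat_def open_dquat_def)+

end

definition Q_DH :: "dquat set"
  where "Q_DH = {of_real \<alpha> + \<beta> *\<^sub>R J | \<alpha> \<beta> J. J \<in> imag_units}"

definition sphere_of :: "dquat \<Rightarrow> dquat set"
  where "sphere_of x = {of_real \<alpha> + \<beta> *\<^sub>R K | \<alpha> \<beta> J K.
    J \<in> imag_units \<and> K \<in> imag_units \<and> x = of_real \<alpha> + \<beta> *\<^sub>R J}"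

definition tangent_plane :: "quat \<Rightarrow> dquat set"
  where "tangent_plane q = {Dual q \<gamma> | \<gamma>. \<gamma> \<in> Im_H \<and> quat_perp \<gamma> (Im_part q)}"

section \<open>Domains\<close>

definition circularization :: "complex set \<Rightarrow> 'a::conjugation_algebra set"
  where "circularization D =
    {of_real \<alpha> + \<beta> *\<^sub>R J | \<alpha> \<beta> J. Complex \<alpha> \<beta> \<in> D \<and> J \<in> imag_units}"

abbreviation Omega :: "complex set \<Rightarrow> dquat set"
  where "Omega \<equiv> circularization"

definition slice_domain :: "complex set \<Rightarrow> bool"
  where "slice_domain D \<longleftrightarrow> open D \<and> connected D \<and> D \<inter> \<real> \<noteq> {} \<and> cnj ` D = D"

definition product_domain :: "complex set \<Rightarrow> bool"
  where "product_domain D \<longleftrightarrow> open D \<and> D \<inter> \<real> = {} \<and>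
    (\<exists>C C'. C \<noteq> C' \<and> components D = {C, C'} \<and> cnj ` C = C' \<and> cnj ` C' = C)"

section \<open>Stem functions and slice functions\<close>

text \<open>The complexified algebra is modelled on pairs: \<^term>\<open>(a, b)\<close> is a + iota b.\<close>

definition iota_mult :: "'a::conjugation_algebra \<times> 'a \<Rightarrow> 'a \<times> 'a"
  where "iota_mult w = (- snd w, fst w)"

definition cpx_mult :: "'a::conjugation_algebra \<times> 'a \<Rightarrow> 'a \<times> 'a \<Rightarrow> 'a \<times> 'a"
  where "cpx_mult w w' =
    (fst w * fst w' - snd w * snd w', fst w * snd w' + snd w * fst w')"

definition cpx_conjugate :: "'a::conjugation_algebra \<times> 'a \<Rightarrow> 'a \<times> 'a"
  where "cpx_conjugate w = (conjugate (fst w), conjugate (snd w))"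

definition stem_function :: "complex set \<Rightarrow> (complex \<Rightarrow> 'a::conjugation_algebra \<times> 'a) \<Rightarrow> bool"
  where "stem_function D F \<longleftrightarrow>
    (\<forall>z\<in>D. fst (F (cnj z)) = fst (F z) \<and> snd (F (cnj z)) = - snd (F z))"

text \<open>The representation of x as \<alpha> + \<beta> J is not unique, but for a stem function on a
  conjugation-invariant D the value below does not depend on it when x lies in the
  circularization of D; elsewhere the value is irrelevant.\<close>

definition slice_fun :: "(complex \<Rightarrow> 'a::conjugation_algebra \<times> 'a) \<Rightarrow> 'a \<Rightarrow> 'a"
  where "slice_fun F x = (THE y. \<exists>\<alpha> \<beta> J. J \<in> imag_units \<and> x = of_real \<alpha> + \<beta> *\<^sub>R J \<and>
    y = fst (F (Complex \<alpha> \<beta>)) + J * snd (F (Complex \<alpha> \<beta>)))"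

text \<open>F is of class C^1 on the open set D, and its partial derivatives
  \<^term>\<open>F' z 1\<close> and \<^term>\<open>F' z \<i>\<close> satisfy the Cauchy-Riemann equation.\<close>

definition regular_stem ::
    "complex set \<Rightarrow> (complex \<Rightarrow> 'a::{conjugation_algebra, real_normed_vector} \<times> 'a) \<Rightarrow> bool"
  where "regular_stem D F \<longleftrightarrow> stem_function D F \<and>
    (\<exists>F' :: complex \<Rightarrow> complex \<Rightarrow>\<^sub>L ('a \<times> 'a).
      (\<forall>z\<in>D. (F has_derivative blinfun_apply (F' z)) (at z)) \<and> continuous_on D F' \<and>
      (\<forall>z\<in>D. blinfun_apply (F' z) 1 + iota_mult (blinfun_apply (F' z) \<i>) = 0))"

definition normal_stem :: "(complex \<Rightarrow> 'a::conjugation_algebra \<times> 'a) \<Rightarrow> complex \<Rightarrow> 'a \<times> 'a"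
  where "normal_stem F z = cpx_mult (F z) (cpx_conjugate (F z))"

definition primal_stem :: "(complex \<Rightarrow> dquat \<times> dquat) \<Rightarrow> complex \<Rightarrow> quat \<times> quat"
  where "primal_stem F z = (primal (fst (F z)), primal (snd (F z)))"

text \<open>\<^term>\<open>slice_regular_by D F f\<close>: f is the slice regular function on \<^term>\<open>Omega D\<close>
  induced by F. The stem function F is determined on D by the values of f on \<^term>\<open>Omega D\<close>.\<close>

definition slice_regular_by ::
    "complex set \<Rightarrow> (complex \<Rightarrow> dquat \<times> dquat) \<Rightarrow> (dquat \<Rightarrow> dquat) \<Rightarrow> bool"
  where "slice_regular_by D F f \<longleftrightarrow> regular_stem D F \<and> (\<forall>x\<in>Omega D. f x = slice_fun F x)"

definition primal_part :: "(complex \<Rightarrow> dquat \<times> dquat) \<Rightarrow> quat \<Rightarrow> quat"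
  where "primal_part F = slice_fun (primal_stem F)"

definition normal_primal_part :: "(complex \<Rightarrow> dquat \<times> dquat) \<Rightarrow> quat \<Rightarrow> quat"
  where "normal_primal_part F = slice_fun (normal_stem (primal_stem F))"

text \<open>The intersection of \<Omega> with the quaternions, as a set of quaternions.\<close>

definition quat_slice :: "dquat set \<Rightarrow> quat set"
  where "quat_slice \<Omega> = {q. Dual q 0 \<in> \<Omega>}"

definition zero_set :: "complex set \<Rightarrow> (dquat \<Rightarrow> dquat) \<Rightarrow> dquat set"
  where "zero_set D f = {x \<in> Omega D. f x = 0}"

text \<open>Evaluation with the coefficients on the right.\<close>

definition eval_right :: "dquat poly \<Rightarrow> dquat \<Rightarrow> dquat"
  where "eval_right P x = (\<Sum>n\<le>degree P. x ^ n * coeff P n)"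

definition isolated_subset :: "'a::topological_space set \<Rightarrow> 'a set \<Rightarrow> bool"
  where "isolated_subset S V \<longleftrightarrow> S \<subseteq> V \<and> (\<exists>U. open U \<and> S \<subseteq> U \<and> U \<inter> (V - S) = {})"

end

theory Submission
  imports Defs "HOL-Complex_Analysis.Complex_Analysis"
begin

text \<open>On the sphere over \<open>z = \<alpha> + i\<beta>\<close> the equation \<open>f = 0\<close> reads \<open>F\<^sub>1(z) + J F\<^sub>2(z) = 0\<close>, which is
  linear in \<open>J\<close>: splitting it into primal and dual parts shows that its solutions form a point, a
  tangent plane or the whole sphere. A solution forces \<open>g(z) = 0\<close>, where \<open>g\<close> is the normal function
  of the primal part. The stem of \<open>g\<close> is complex valued, namely the sum of the squares of the four
  holomorphic components of the primal stem, so its zeros are isolated as soon as it does not vanish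
  identically on any component of \<open>D\<close>. For a polynomial \<open>f\<close>, \<open>g\<close> is a nonzero complex polynomial.\<close>

section \<open>Slices of a real algebra with conjugation\<close>

lemma conjugate_one [simp]: "conjugate (1::'a::conjugation_algebra) = 1"
proof -
  have "conjugate (conjugate (1::'a) * 1) = conjugate 1 * conjugate (conjugate 1)"
    by (rule conjugate_mult)
  then show ?thesis by simp
qed

lemma conjugate_of_real [simp]:
  "conjugate (of_real r :: 'a::conjugation_algebra) = of_real r"
  by (simp add: of_real_def conjugate_scaleR)

lemma conjugate_minus: "conjugate (- x) = - conjugate (x::'a::conjugation_algebra)"
  using conjugate_scaleR[of "-1" x] by simp

lemma conjugate_imag_unit: "J \<in> imag_units \<Longrightarrow> conjugate J = - J"
  by (auto simp: imag_units_def trace_conj_def dest: minus_unique)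

lemma imag_unit_square: "J \<in> imag_units \<Longrightarrow> J * J = - 1"
  using conjugate_imag_unit[of J]
  by (metis (mono_tags, lifting) imag_units_def mem_Collect_eq minus_minus
      mult_minus_right norm_conj_def)

lemma uminus_imag_unit:
  assumes "J \<in> imag_units" shows "- J \<in> imag_units"
  using conjugate_imag_unit[OF assms] imag_unit_square[OF assms]
  by (simp add: imag_units_def trace_conj_def norm_conj_def conjugate_minus)

text \<open>Conjugation flips only the sign of the imaginary term, so adding the conjugate isolates
  \<open>a\<close>; squaring \<open>b *\<^sub>R J\<close> then fixes \<open>b\<close> up to sign,
  because J J = -1.\<close>

lemma slice_representation_unique:
  fixes J J' :: "'a::conjugation_algebra"
  assumes J: "J \<in> imag_units" and J': "J' \<in> imag_units"
    and eq: "of_real a + b *\<^sub>R J = of_real a' + b' *\<^sub>R J'"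
  shows "a' = a" and "b' = b \<and> (b = 0 \<or> J' = J) \<or> b' = - b \<and> (b = 0 \<or> J' = - J)"
proof -
  have "conjugate (of_real a + b *\<^sub>R J) = conjugate (of_real a' + b' *\<^sub>R J')"
    using eq by simp
  then have "of_real a - b *\<^sub>R J = of_real a' - b' *\<^sub>R J'"
    by (simp add: conjugate_add conjugate_scaleR conjugate_imag_unit J J')
  then have "(of_real a + b *\<^sub>R J) + (of_real a - b *\<^sub>R J)
      = (of_real a' + b' *\<^sub>R J') + (of_real a' - b' *\<^sub>R J')"
    using eq by simp
  then have "(of_real a + of_real a :: 'a) = of_real a' + of_real a'" by simp
  then have "(of_real (a + a) :: 'a) = of_real (a' + a')" by (simp only: of_real_add)
  then have "a + a = a' + a'" by (simp only: of_real_eq_iff)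
  then show a: "a' = a" by simp
  have bJ: "b *\<^sub>R J = b' *\<^sub>R J'" using eq a by simp
  then have "(b *\<^sub>R J) * (b *\<^sub>R J) = (b' *\<^sub>R J') * (b' *\<^sub>R J')" by simp
  then have "(of_real (b * b) :: 'a) = of_real (b' * b')"
    by (simp add: imag_unit_square J J' of_real_def)
  then have "b * b = b' * b'" by (simp only: of_real_eq_iff)
  then have "b' = b \<or> b' = - b" by (metis square_eq_iff)
  with bJ show "b' = b \<and> (b = 0 \<or> J' = J) \<or> b' = - b \<and> (b = 0 \<or> J' = - J)"
    by (auto simp flip: scaleR_minus_right)
qed

lemma eq_minus_self_iff: "x = - x \<longleftrightarrow> x = (0::'a::real_vector)"
proof
  assume "x = - x"
  then have "x + x = 0" by (simp only: eq_neg_iff_add_eq_0)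
  then have "2 *\<^sub>R x = 0" by (simp only: scaleR_2)
  then show "x = 0" by simp
qed simp

text \<open>Makes the definite description in \<open>slice_fun\<close> computable: the parity of a
  stem function absorbs the change from (b, J) to (-b, -J), and it forces the second component to
  vanish on the real axis, where \<open>J\<close> is arbitrary.\<close>

lemma slice_fun_eq:
  assumes F: "stem_function D F" and z: "Complex a b \<in> D" and J: "J \<in> imag_units"
  shows "slice_fun F (of_real a + b *\<^sub>R J) = fst (F (Complex a b)) + J * snd (F (Complex a b))"
  unfolding slice_fun_def
proof (rule the_equality)
  fix y
  assume "\<exists>\<alpha> \<beta> K. K \<in> imag_units \<and> of_real a + b *\<^sub>R J = of_real \<alpha> + \<beta> *\<^sub>R K \<and>
    y = fst (F (Complex \<alpha> \<beta>)) + K * snd (F (Complex \<alpha> \<beta>))"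
  then obtain \<alpha> \<beta> K where K: "K \<in> imag_units"
    and eq: "of_real a + b *\<^sub>R J = of_real \<alpha> + \<beta> *\<^sub>R K"
    and y: "y = fst (F (Complex \<alpha> \<beta>)) + K * snd (F (Complex \<alpha> \<beta>))"
    by blast
  have cnj: "cnj (Complex a b) = Complex a (- b)" by (simp add: complex_eq_iff)
  have F': "fst (F (Complex a (- b))) = fst (F (Complex a b))"
    "snd (F (Complex a (- b))) = - snd (F (Complex a b))"
    using F z unfolding stem_function_def cnj[symmetric] by blast+
  have snd0: "snd (F (Complex a b)) = 0" if "b = 0"
    using F'(2) that by (simp add: eq_minus_self_iff)
  show "y = fst (F (Complex a b)) + J * snd (F (Complex a b))"
    using slice_representation_unique[OF J K eq] F' snd0 y by (cases "b = 0") auto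
qed (use J in blast)

section \<open>Quaternions and dual quaternions\<close>

text \<open>Right multiplication of p q = 0 by the conjugate of \<open>q\<close> leaves |q|^2 p =
  0.\<close>

lemma quat_mult_eq_0_iff: "p * q = 0 \<longleftrightarrow> p = 0 \<or> q = (0::quat)"
proof
  assume pq: "p * q = 0"
  have "q * conjugate q = of_real (inner q q)"
    by (simp add: quat_eq_iff conjugate_quat_def inner_quat_def of_real_def)
  then have "of_real (inner q q) * p = (p * q) * conjugate q"
    by (simp add: mult.assoc of_real_def)
  with pq have "inner q q *\<^sub>R p = 0" by (simp add: of_real_def)
  then show "p = 0 \<or> q = 0" by auto
next
  show "p = 0 \<or> q = 0 \<Longrightarrow> p * q = 0" by auto
qed

lemma imag_units_quat_iff: "J \<in> imag_units \<longleftrightarrow> Re_q J = 0 \<and> inner J J = 1"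
  by (auto simp: imag_units_def trace_conj_def norm_conj_def quat_eq_iff conjugate_quat_def
      inner_quat_def)

text \<open>The dual component of n(J) = 1 is an orthogonality relation: a dual imaginary unit is a
  tangent vector to the 2-sphere of quaternionic imaginary units, based at its primal part.\<close>

lemma imag_units_dquat_iff:
  "J \<in> imag_units \<longleftrightarrow>
    primal J \<in> imag_units \<and> Re_q (dual J) = 0 \<and> inner (primal J) (dual J) = 0"
  by (auto simp: imag_units_def trace_conj_def norm_conj_def dquat_eq_iff quat_eq_iff
      conjugate_quat_def conjugate_dquat_def inner_quat_def algebra_simps)

lemma imag_unit_dquat_i: "Dual (Quat 0 1 0 0) 0 \<in> imag_units"
  by (simp add: imag_units_dquat_iff imag_units_quat_iff inner_quat_def)

lemma primal_of_real [simp]: "primal (of_real r) = of_real r"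
  and dual_of_real [simp]: "dual (of_real r) = 0"
  by (simp_all add: of_real_def)

lemma Re_q_of_real [simp]: "Re_q (of_real r) = r"
  by (simp add: of_real_def)

lemma Im_part_of_real_add:
  "Re_q q = 0 \<Longrightarrow> Im_part (of_real a + b *\<^sub>R q) = b *\<^sub>R q"
  by (simp add: Im_part_def quat_eq_iff of_real_def)

text \<open>The norm selects the representative in the closed upper half-plane, which removes the
  sign ambiguity of (b, J). As a continuous map on all dual quaternions, it pulls discs back to open
  sets.\<close>

definition slice_coord :: "dquat \<Rightarrow> complex"
  where "slice_coord x = Complex (Re_q (primal x)) (norm (Im_part (primal x)))"

lemma slice_coord_eq:
  "J \<in> imag_units \<Longrightarrow> slice_coord (of_real a + b *\<^sub>R J) = Complex a \<bar>b\<bar>"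
  by (simp add: slice_coord_def imag_units_dquat_iff imag_units_quat_iff Im_part_of_real_add
      norm_eq_sqrt_inner)

lemma continuous_slice_coord: "continuous_on UNIV slice_coord"
proof -
  have "linear (\<lambda>x. Re_q (primal x))" and "linear (\<lambda>x. Im_part (primal x))"
    by (auto intro!: linearI simp: Im_part_def quat_eq_iff)
  then have "continuous_on UNIV (\<lambda>x. Re_q (primal x))"
    "continuous_on UNIV (\<lambda>x. Im_part (primal x))"
    by (auto intro: linear_continuous_on simp: linear_conv_bounded_linear)
  then show ?thesis
    unfolding slice_coord_def Complex_eq by (intro continuous_intros)
qed

lemma Q_DH_cases:
  assumes "x \<in> Q_DH"
  obtains J where "J \<in> imag_units"
    and "x = of_real (Re (slice_coord x)) + Im (slice_coord x) *\<^sub>R J"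
proof -
  obtain a b J where x: "x = of_real a + b *\<^sub>R J" and J: "J \<in> imag_units"
    using assms by (auto simp: Q_DH_def)
  show thesis
  proof (cases "b \<ge> 0")
    case True
    then show thesis using that[OF J] x slice_coord_eq[OF J] by simp
  next
    case False
    then show thesis
      using that[OF uminus_imag_unit[OF J]] x slice_coord_eq[OF J, of a b] by simp
  qed
qed

lemma Omega_iff:
  assumes D: "cnj ` D = D"
  shows "x \<in> Omega D \<longleftrightarrow> x \<in> Q_DH \<and> slice_coord x \<in> D"
proof
  assume "x \<in> Omega D"
  then obtain a b J where x: "x = of_real a + b *\<^sub>R J" and J: "J \<in> imag_units"
    and z: "Complex a b \<in> D"
    by (auto simp: circularization_def)
  have "cnj (Complex a b) \<in> D" using D z by blast
  then have "Complex a \<bar>b\<bar> \<in> D" using z by (cases "b \<ge> 0") (auto simp: complex_cnj)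
  then show "x \<in> Q_DH \<and> slice_coord x \<in> D"
    using x J by (auto simp: slice_coord_eq Q_DH_def)
next
  assume x: "x \<in> Q_DH \<and> slice_coord x \<in> D"
  then obtain J where "J \<in> imag_units"
    and "x = of_real (Re (slice_coord x)) + Im (slice_coord x) *\<^sub>R J"
    using Q_DH_cases by blast
  with x show "x \<in> Omega D"
    unfolding circularization_def by (metis (mono_tags, lifting) complex.collapse mem_Collect_eq)
qed

text \<open>Spheres are fibres of \<open>slice_coord\<close> on \<open>Q_DH\<close>, so distinct
  spheres can be separated in the complex plane.\<close>

lemma sphere_of_eq:
  assumes "y \<in> Q_DH"
  shows "sphere_of y = {x \<in> Q_DH. slice_coord x = slice_coord y}"
proof (intro set_eqI iffI)
  fix x assume "x \<in> sphere_of y"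
  then show "x \<in> {x \<in> Q_DH. slice_coord x = slice_coord y}"
    by (auto simp: sphere_of_def Q_DH_def slice_coord_eq)
next
  fix x assume "x \<in> {x \<in> Q_DH. slice_coord x = slice_coord y}"
  then have x: "x \<in> Q_DH" "slice_coord x = slice_coord y" by auto
  then obtain K where K: "K \<in> imag_units"
    "x = of_real (Re (slice_coord y)) + Im (slice_coord y) *\<^sub>R K"
    using Q_DH_cases[OF x(1)] by metis
  obtain J where J: "J \<in> imag_units"
    "y = of_real (Re (slice_coord y)) + Im (slice_coord y) *\<^sub>R J"
    using Q_DH_cases[OF assms] by metis
  show "x \<in> sphere_of y"
    unfolding sphere_of_def using J K by blast
qed

text \<open>With the primal part of \<open>K\<close> fixed, \<open>dual K\<close> runs through the
  imaginary vectors orthogonal to \<open>primal J\<close>; scaling by the nonzero \<open>b\<close>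
  maps this plane onto itself.\<close>

lemma tangent_plane_eq:
  assumes J: "J \<in> imag_units" and b: "b \<noteq> 0"
  shows "tangent_plane (primal (of_real a + b *\<^sub>R J))
    = {of_real a + b *\<^sub>R K |K. K \<in> imag_units \<and> primal K = primal J}"
proof -
  have Im: "Im_part (primal (of_real a + b *\<^sub>R J)) = b *\<^sub>R primal J"
    using J by (simp add: imag_units_dquat_iff imag_units_quat_iff Im_part_of_real_add)
  have perp: "quat_perp \<gamma> q \<longleftrightarrow> inner q \<gamma> = 0" for \<gamma> q
    by (auto simp: quat_perp_def quat_eq_iff conjugate_quat_def inner_quat_def algebra_simps)
  show ?thesis
  proof (intro set_eqI iffI)
    fix x assume "x \<in> tangent_plane (primal (of_real a + b *\<^sub>R J))"
    then obtain \<gamma> where x: "x = Dual (primal (of_real a + b *\<^sub>R J)) \<gamma>"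
      and \<gamma>: "Re_q \<gamma> = 0" "inner (primal J) \<gamma> = 0"
      using b unfolding tangent_plane_def Im perp by (auto simp: Im_H_def)
    define K where "K = Dual (primal J) ((1/b) *\<^sub>R \<gamma>)"
    have "K \<in> imag_units" "primal K = primal J" "x = of_real a + b *\<^sub>R K"
      using J \<gamma> b x by (auto simp: K_def imag_units_dquat_iff dquat_eq_iff)
    then show "x \<in> {of_real a + b *\<^sub>R K |K. K \<in> imag_units \<and> primal K = primal J}" by blast
  next
    fix x assume "x \<in> {of_real a + b *\<^sub>R K |K. K \<in> imag_units \<and> primal K = primal J}"
    then show "x \<in> tangent_plane (primal (of_real a + b *\<^sub>R J))"
      unfolding tangent_plane_def Im perp
      by (auto simp: imag_units_dquat_iff dquat_eq_iff Im_H_def)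
  qed
qed

text \<open>Separating primal and dual parts of \<open>A + J * B = 0\<close> gives \<open>A\<^sub>1 + J\<^sub>1 * B\<^sub>1 = 0\<close> and
  \<open>A\<^sub>2 + J\<^sub>1 * B\<^sub>2 + J\<^sub>2 * B\<^sub>1 = 0\<close>: if \<open>B\<^sub>1 \<noteq> 0\<close> these determine \<open>J\<close>; if \<open>B\<^sub>1 = 0 \<noteq> B\<^sub>2\<close> they
  determine \<open>J\<^sub>1\<close> and leave \<open>J\<^sub>2\<close> free; if \<open>B = 0\<close> then \<open>J\<close> is arbitrary.\<close>

lemma affine_imag_unit_solutions:
  fixes A B :: dquat
  assumes J: "J \<in> imag_units" and zero: "A + J * B = 0"
  defines "Z \<equiv> {K \<in> imag_units. A + K * B = 0}"
  shows "Z = {J} \<or> Z = {K \<in> imag_units. primal K = primal J} \<or> Z = imag_units"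
proof -
  \<comment> \<open>Subtracting the known solution makes the equation homogeneous, (K - J) B = 0, so
    that only \<open>B\<close> decides the case.\<close>
  have "A = - (J * B)" using zero by (simp add: eq_neg_iff_add_eq_0)
  then have "A + K * B = (K - J) * B" for K by (simp add: algebra_simps)
  then have Z: "Z = {K \<in> imag_units. (K - J) * B = 0}" by (simp add: Z_def)
  consider "primal B \<noteq> 0" | "primal B = 0" "dual B \<noteq> 0" | "B = 0"
    by (auto simp: dquat_eq_iff)
  then show ?thesis
  proof cases
    case 1
    then have "Z = {J}"
      using J by (auto simp: Z dquat_eq_iff quat_mult_eq_0_iff)
    then show ?thesis by blast
  next
    case 2
    then have "Z = {K \<in> imag_units. primal K = primal J}"
      by (auto simp: Z dquat_eq_iff quat_mult_eq_0_iff)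
    then show ?thesis by blast
  next
    case 3
    then show ?thesis by (simp add: Z)
  qed
qed

section \<open>The normal function of the primal part\<close>

text \<open>This is the complex coordinate along \<open>u\<close> of a point of the complexified
  algebra: multiplication by iota becomes multiplication by i.\<close>

definition stem_component :: "'a::real_inner \<Rightarrow> (complex \<Rightarrow> 'a \<times> 'a) \<Rightarrow> complex \<Rightarrow> complex"
  where "stem_component u F z = Complex (inner u (fst (F z))) (inner u (snd (F z)))"

lemma holomorphic_stem_component:
  fixes F :: "complex \<Rightarrow> 'a::{conjugation_algebra, euclidean_space} \<times> 'a"
  assumes "regular_stem D F"
  shows "stem_component u F holomorphic_on D"
proof -
  obtain F' :: "complex \<Rightarrow> complex \<Rightarrow>\<^sub>L ('a \<times> 'a)"
    where der: "\<And>z. z \<in> D \<Longrightarrow> (F has_derivative blinfun_apply (F' z)) (at z)"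
      and CR: "\<And>z. z \<in> D \<Longrightarrow> blinfun_apply (F' z) 1 + iota_mult (blinfun_apply (F' z) \<i>) = 0"
    using assms unfolding regular_stem_def by blast
  show ?thesis
    unfolding holomorphic_on_def
  proof
    fix z assume z: "z \<in> D"
    define G where "G w = blinfun_apply (F' z) w" for w
    define L where "L p = Complex (inner u (fst p)) (inner u (snd p))" for p :: "'a \<times> 'a"
    have "bounded_linear L"
      unfolding linear_conv_bounded_linear[symmetric]
      by (auto intro!: linearI simp: L_def complex_eq_iff inner_add_right)
    then have "((\<lambda>w. L (F w)) has_derivative (\<lambda>w. L (G w))) (at z)"
      using der[OF z] unfolding G_def by (rule bounded_linear.has_derivative)
    \<comment> \<open>The Cauchy-Riemann equation makes this real linear map commute with i, so it
      is multiplication by its value at 1.\<close>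
    moreover have "L (G w) = L (G 1) * w" for w
    proof -
      have "fst (G 1) = snd (G \<i>)" "snd (G 1) = - fst (G \<i>)"
        using CR[OF z]
        by (simp_all add: G_def iota_mult_def prod_eq_iff eq_neg_iff_add_eq_0)
      then have Gi: "L (G \<i>) = \<i> * L (G 1)"
        by (simp add: L_def complex_eq_iff)
      have "w = Re w *\<^sub>R 1 + Im w *\<^sub>R \<i>" by (simp add: complex_eq_iff)
      then have "G w = Re w *\<^sub>R G 1 + Im w *\<^sub>R G \<i>"
        unfolding G_def by (metis blinfun.add_right blinfun.scaleR_right)
      then have "L (G w) = Re w *\<^sub>R L (G 1) + Im w *\<^sub>R L (G \<i>)"
        by (simp add: L_def inner_add_right complex_eq_iff)
      then show ?thesis
        by (simp add: Gi complex_eq_iff algebra_simps)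
    qed
    then have "(\<lambda>w. L (G w)) = (*) (L (G 1))" by (rule ext)
    ultimately have "((\<lambda>w. L (F w)) has_field_derivative L (G 1)) (at z)"
      unfolding has_field_derivative_def by simp
    then show "stem_component u F field_differentiable at z within D"
      unfolding stem_component_def[abs_def] L_def
      by (auto simp: field_differentiable_def intro: has_field_derivative_at_within)
  qed
qed

text \<open>A complexified quaternion times its conjugate is the complex scalar given by this sum of
  squares of coordinates; \<open>normal_stem_primal\<close> makes the link.\<close>

definition complex_normal :: "(complex \<Rightarrow> dquat \<times> dquat) \<Rightarrow> complex \<Rightarrow> complex"
  where "complex_normal F z = (\<Sum>b\<in>Basis. (stem_component b (primal_stem F) z)\<^sup>2)"

lemma stem_component_primal:
  "stem_component b (primal_stem F) = stem_component (Dual b 0) F"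
  by (simp add: fun_eq_iff stem_component_def primal_stem_def inner_dquat_def)

lemma holomorphic_complex_normal:
  "regular_stem D F \<Longrightarrow> complex_normal F holomorphic_on D"
  unfolding complex_normal_def[abs_def] stem_component_primal
  by (intro holomorphic_intros holomorphic_stem_component)

lemma complex_normal_eq:
  "complex_normal F z =
    (let a = primal (fst (F z)); b = primal (snd (F z)) in
      Complex (inner a a - inner b b) (2 * inner a b))"
  by (simp add: complex_normal_def stem_component_def primal_stem_def complex_eq_iff Let_def
      Basis_quat_def inner_quat_def power2_eq_square)

text \<open>The primal part of the equation reads a = -p b with \<open>p\<close> an imaginary unit.
  Left multiplication by \<open>p\<close> is an isometry sending \<open>b\<close> to a vector
  orthogonal to it, so |a| = |b| and a is orthogonal to b.\<close>

lemma complex_normal_zero: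
  assumes J: "J \<in> imag_units" and zero: "fst (F z) + J * snd (F z) = 0"
  shows "complex_normal F z = 0"
proof -
  define p b where "p = primal J" and "b = primal (snd (F z))"
  have "primal (fst (F z) + J * snd (F z)) = 0" using zero by simp
  then have a: "primal (fst (F z)) = - (p * b)"
    by (simp add: p_def b_def eq_neg_iff_add_eq_0)
  have p: "Re_q p = 0" "inner p p = 1"
    using J by (simp_all add: p_def imag_units_dquat_iff imag_units_quat_iff)
  have "inner (p * b) (p * b) = inner p p * inner b b"
    by (simp add: inner_quat_def algebra_simps)
  moreover have "inner (p * b) b = Re_q p * inner b b"
    by (simp add: inner_quat_def algebra_simps)
  ultimately show ?thesis
    using p by (simp add: complex_normal_eq Let_def a complex_eq_iff flip: b_def)
qed

lemma normal_stem_primal: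
  "normal_stem (primal_stem F) z =
    (of_real (Re (complex_normal F z)), of_real (Im (complex_normal F z)))"
  by (simp add: normal_stem_def primal_stem_def cpx_mult_def cpx_conjugate_def complex_normal_eq
      Let_def quat_eq_iff conjugate_quat_def inner_quat_def of_real_def)

lemma stem_primal: "stem_function D F \<Longrightarrow> stem_function D (primal_stem F)"
  by (simp add: stem_function_def primal_stem_def)

lemma stem_normal: "stem_function D F \<Longrightarrow> stem_function D (normal_stem F)"
  by (simp add: stem_function_def normal_stem_def cpx_mult_def cpx_conjugate_def conjugate_minus)

lemma complex_normal_cnj:
  "stem_function D F \<Longrightarrow> z \<in> D \<Longrightarrow> complex_normal F (cnj z) = cnj (complex_normal F z)"
  by (simp add: stem_function_def complex_normal_eq Let_def complex_eq_iff)

lemma quat_slice_cases: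
  assumes "q \<in> quat_slice (Omega D)"
  obtains a b J where "J \<in> imag_units" "Complex a b \<in> D" "q = of_real a + b *\<^sub>R J"
proof -
  obtain a b J where J: "J \<in> imag_units" and z: "Complex a b \<in> D"
    and q: "Dual q 0 = of_real a + b *\<^sub>R J"
    using assms by (auto simp: quat_slice_def circularization_def)
  have "q = of_real a + b *\<^sub>R primal J"
    using q by (simp add: dquat_eq_iff)
  moreover have "primal J \<in> imag_units" using J by (simp add: imag_units_dquat_iff)
  ultimately show thesis using that z by blast
qed

section \<open>Nonvanishing of the normal function and isolation of its zeros\<close>

lemma product_domain_cnj: "product_domain D \<Longrightarrow> cnj ` D = D"
  unfolding product_domain_def
  by (metis Union_components
      Union_insert Union_empty image_Un sup_bot_right sup_commute)

text \<open>At a zero of \<open>g\<close> this is the identity principle, elsewhere mere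
  continuity.\<close>

lemma holomorphic_zero_isolated:
  assumes g: "g holomorphic_on C" and C: "open C" "connected C"
    and w: "w \<in> C" "g w \<noteq> 0" and z: "z \<in> C"
  obtains r where "r > 0" "\<And>u. u \<in> ball z r \<Longrightarrow> u \<noteq> z \<Longrightarrow> g u \<noteq> 0"
proof (cases "g z = 0")
  case True
  show thesis
    by (rule isolated_zeros[OF g C z True w]) (use that in auto)
next
  case False
  have "continuous (at z) g"
    using g C z by (metis continuous_on_eq_continuous_at holomorphic_on_imp_continuous_on)
  then obtain r where "r > 0" "\<forall>u. dist z u < r \<longrightarrow> g u \<noteq> 0"
    using continuous_at_avoid[of z g 0] False by blast
  then show thesis using that by auto
qed

text \<open>On the real axis the stem components are real, so the vanishing of the sum of their squares
  forces each of them to vanish; the identity principle then spreads this over a slice domain.\<close>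

lemma complex_normal_nonzero_slice_domain:
  assumes F: "regular_stem D F" and D: "slice_domain D"
    and q: "q \<in> quat_slice (Omega D)" "primal_part F q \<noteq> 0"
  shows "\<exists>w\<in>D. complex_normal F w \<noteq> 0"
proof (rule ccontr)
  assume "\<not> ?thesis"
  then have N: "complex_normal F w = 0" if "w \<in> D" for w using that by blast
  have stem: "stem_function D F" using F by (simp add: regular_stem_def)
  have D': "open D" "connected D" using D by (auto simp: slice_domain_def)
  obtain x where x: "complex_of_real x \<in> D"
    using D by (auto simp: slice_domain_def Reals_def)
  have comp: "stem_component b (primal_stem F) (of_real t) = 0" if t: "complex_of_real t \<in> D" for b t
  proof -
    \<comment> \<open>A real point is its own conjugate, so the odd component vanishes there and
      \<open>complex_normal\<close> reduces to the squared norm of the primal first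
      component.\<close>
    have "snd (F (of_real t)) = - snd (F (of_real t))"
      using stem t unfolding stem_function_def by (metis complex_cnj_complex_of_real)
    then have "snd (F (of_real t)) = 0" by (simp only: eq_minus_self_iff)
    moreover from this have "primal (fst (F (of_real t))) = 0"
      using N[OF t] by (simp add: complex_normal_eq Let_def complex_eq_iff)
    ultimately show ?thesis by (simp add: stem_component_def primal_stem_def complex_eq_iff)
  qed
  \<comment> \<open>Since \<open>D\<close> is open, it contains a real interval around
    \<open>x\<close>; this supplies the accumulation point for the identity principle.\<close>
  have lim: "complex_of_real x islimpt (D \<inter> \<real>)"
    unfolding islimpt_approachable
  proof (intro allI impI)
    fix e :: real assume "e > 0"
    obtain d where d: "d > 0" "ball (complex_of_real x) d \<subseteq> D"
      using D' x by (meson openE)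
    define t where "t = x + min d e / 2"
    have "dist (complex_of_real t) (of_real x) = min d e / 2"
      using d \<open>e > 0\<close> by (simp add: t_def dist_norm)
    then have "dist (complex_of_real t) (of_real x) < e" "complex_of_real t \<in> ball (of_real x) d"
      "t \<noteq> x"
      using d \<open>e > 0\<close> by (auto simp: t_def dist_commute)
    then show "\<exists>x'\<in>D \<inter> \<real>. x' \<noteq> complex_of_real x \<and> dist x' (of_real x) < e"
      using d by (intro bexI[of _ "complex_of_real t"]) auto
  qed
  have comp0: "stem_component b (primal_stem F) w = 0" if "w \<in> D" for b w
  proof (rule analytic_continuation[of "stem_component b (primal_stem F)" D "D \<inter> \<real>"
        "complex_of_real x"])
    show "stem_component b (primal_stem F) holomorphic_on D"
      unfolding stem_component_primal by (rule holomorphic_stem_component[OF F])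
  qed (use D' x lim comp that in \<open>auto elim!: Reals_cases\<close>)
  \<comment> \<open>The direction in \<open>comp0\<close> is arbitrary, so each entry can be paired
    with itself, which yields its squared norm.\<close>
  have primal0: "primal_stem F w = 0" if "w \<in> D" for w
    using comp0[OF that, of "fst (primal_stem F w)"] comp0[OF that, of "snd (primal_stem F w)"]
    by (simp add: stem_component_def complex_eq_iff prod_eq_iff)
  obtain a b J where J: "J \<in> imag_units" and z: "Complex a b \<in> D"
    and q': "q = of_real a + b *\<^sub>R J"
    using quat_slice_cases[OF q(1)] .
  have "primal_part F q = 0"
    unfolding primal_part_def q' slice_fun_eq[OF stem_primal[OF stem] z J] by (simp add: primal0 z)
  with q(2) show False by simp
qed

lemma complex_normal_nonzero_product_domain:
  assumes F: "regular_stem D F" and q: "q \<in> quat_slice (Omega D)" "normal_primal_part F q \<noteq> 0"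
  shows "\<exists>w\<in>D. complex_normal F w \<noteq> 0"
proof -
  have stem: "stem_function D F" using F by (simp add: regular_stem_def)
  obtain a b J where J: "J \<in> imag_units" and z: "Complex a b \<in> D"
    and q': "q = of_real a + b *\<^sub>R J"
    using quat_slice_cases[OF q(1)] .
  have "complex_normal F (Complex a b) \<noteq> 0"
    using q(2) unfolding normal_primal_part_def q'
      slice_fun_eq[OF stem_normal[OF stem_primal[OF stem]] z J]
    by (auto simp: normal_stem_primal)
  with z show ?thesis by blast
qed

lemma complex_normal_nonzero:
  assumes "regular_stem D F"
    and "slice_domain D \<and> (\<exists>q\<in>quat_slice (Omega D). primal_part F q \<noteq> 0)
       \<or> product_domain D \<and> (\<exists>q\<in>quat_slice (Omega D). normal_primal_part F q \<noteq> 0)"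
  shows "\<exists>w\<in>D. complex_normal F w \<noteq> 0"
  using assms complex_normal_nonzero_slice_domain complex_normal_nonzero_product_domain by blast

text \<open>A slice domain is connected. In a product domain \<open>w\<close> may lie in the
  component that misses \<open>z\<close>; then \<open>cnj w\<close> lies in the right one, and
  \<open>complex_normal_cnj\<close> keeps the value nonzero.\<close>

lemma complex_normal_zeros_isolated:
  assumes F: "regular_stem D F"
    and D: "slice_domain D \<or> product_domain D" and w: "w \<in> D" "complex_normal F w \<noteq> 0"
    and z: "z \<in> D"
  obtains r where "r > 0" "\<And>u. u \<in> ball z r \<Longrightarrow> u \<noteq> z \<Longrightarrow> complex_normal F u \<noteq> 0"
  using D
proof
  assume "slice_domain D"
  then show thesis
    using holomorphic_zero_isolated[OF holomorphic_complex_normal[OF F] _ _ w z] that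
    by (auto simp: slice_domain_def)
next
  assume prod: "product_domain D"
  then obtain C C' where D': "open D" "components D = {C, C'}" "cnj ` C = C'" "cnj ` C' = C"
    by (auto simp: product_domain_def)
  have stem: "stem_function D F" using F by (simp add: regular_stem_def)
  have DU: "D = C \<union> C'" using D'(2) Union_components[of D] by simp
  obtain E where E: "E \<in> {C, C'}" "z \<in> E" using z DU by blast
  have E': "open E" "connected E"
    using E D' by (auto intro: open_components in_components_connected)
  have "w \<in> E \<or> cnj w \<in> E" using E w DU D'(3,4) by blast
  moreover have "complex_normal F (cnj w) \<noteq> 0" using complex_normal_cnj[OF stem w(1)] w by simp
  ultimately obtain w' where w': "w' \<in> E" "complex_normal F w' \<noteq> 0" using w by blast
  have "complex_normal F holomorphic_on E"
    using holomorphic_complex_normal[OF F] E DU by (auto intro: holomorphic_on_subset)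
  then show thesis
    by (rule holomorphic_zero_isolated[of "complex_normal F", OF _ E' w' E(2)]) (use that in blast)
qed

section \<open>Polynomials\<close>

text \<open>As J J = -1, sending i to \<open>J\<close> embeds the complex numbers as a real
  algebra.\<close>

lemma slice_power:
  fixes J :: "'a::conjugation_algebra"
  assumes J: "J \<in> imag_units"
  shows "(of_real (Re z) + Im z *\<^sub>R J) ^ n = of_real (Re (z ^ n)) + Im (z ^ n) *\<^sub>R J"
proof (induction n)
  case (Suc n)
  show ?case
    unfolding power_Suc Suc.IH
    by (simp add: of_real_def imag_unit_square[OF J] algebra_simps)
qed simp

text \<open>The values of \<open>f\<close> determine its stem: comparing them at \<open>J\<close>
  and \<open>- J\<close> separates the two components.\<close>

lemma polynomial_stem:
  assumes F: "stem_function UNIV F" and f: "\<And>x. x \<in> Q_DH \<Longrightarrow> slice_fun F x = eval_right P x"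
  shows "fst (F z) = (\<Sum>n\<le>degree P. Re (z ^ n) *\<^sub>R coeff P n)"
    and "snd (F z) = (\<Sum>n\<le>degree P. Im (z ^ n) *\<^sub>R coeff P n)"
proof -
  define A B where "A = (\<Sum>n\<le>degree P. Re (z ^ n) *\<^sub>R coeff P n)"
    and "B = (\<Sum>n\<le>degree P. Im (z ^ n) *\<^sub>R coeff P n)"
  have eq: "fst (F z) + J * snd (F z) = A + J * B" if J: "J \<in> imag_units" for J
  proof -
    let ?x = "of_real (Re z) + Im z *\<^sub>R J"
    have "fst (F z) + J * snd (F z) = slice_fun F ?x"
      using slice_fun_eq[OF F, of "Re z" "Im z" J] J by simp
    also have "\<dots> = eval_right P ?x"
      by (rule f) (use J in \<open>auto simp: Q_DH_def\<close>)
    also have "\<dots> = A + J * B"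
      unfolding eval_right_def slice_power[OF J]
      by (simp add: A_def B_def of_real_def algebra_simps sum.distrib sum_distrib_left)
    finally show ?thesis .
  qed
  obtain J :: dquat where J: "J \<in> imag_units" using imag_unit_dquat_i by blast
  have 1: "fst (F z) + J * snd (F z) = A + J * B" using eq[OF J] .
  have 2: "fst (F z) - J * snd (F z) = A - J * B" using eq[OF uminus_imag_unit[OF J]] by simp
  have "2 *\<^sub>R fst (F z) = 2 *\<^sub>R A"
    using arg_cong2[OF 1 2, of "(+)"] by (simp add: scaleR_2)
  then show "fst (F z) = A" by simp
  \<comment> \<open>Multiplying once more by \<open>J\<close> cancels it, since J J = -1.\<close>
  with 1 have "J * (J * snd (F z)) = J * (J * B)" by simp
  then show "snd (F z) = B" by (simp add: imag_unit_square[OF J] flip: mult.assoc)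
qed

text \<open>Each stem component is a complex polynomial whose coefficients are coordinates of the
  primal parts of those of \<open>P\<close>; the sum of squares is again a polynomial, nonzero
  because of \<open>w\<close>.\<close>

lemma complex_normal_polynomial_finite:
  assumes F: "stem_function UNIV F" and f: "\<And>x. x \<in> Q_DH \<Longrightarrow> slice_fun F x = eval_right P x"
    and w: "complex_normal F w \<noteq> 0"
  shows "finite {z. complex_normal F z = 0}"
proof -
  define p :: "complex poly" where "p = (\<Sum>b\<in>Basis.
    (\<Sum>n\<le>degree P. monom (of_real (inner b (primal (coeff P n)))) n)\<^sup>2)"
  have primal_sum: "primal (\<Sum>n\<le>k. h n) = (\<Sum>n\<le>k. primal (h n))" for h and k :: nat
    by (induction k) auto
  have "stem_component b (primal_stem F) z
      = poly (\<Sum>n\<le>degree P. monom (of_real (inner b (primal (coeff P n)))) n) z" for b z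
    by (simp add: stem_component_def primal_stem_def polynomial_stem[OF F f] primal_sum
        poly_sum poly_monom inner_sum_right complex_eq_iff mult.commute)
  then have p: "poly p z = complex_normal F z" for z
    by (simp add: p_def complex_normal_def poly_sum poly_power)
  then have "p \<noteq> 0" using w by auto
  then show ?thesis using poly_roots_finite[of p] p by simp
qed

text \<open>\<open>slice_coord\<close> yields the closed upper half-plane, conjugation the rest.
  This puts the polynomial case in the setting of a stem on all of the complex plane.\<close>

lemma Omega_eq_Q_DH_D:
  assumes D: "cnj ` D = D" and "Omega D = Q_DH"
  shows "D = UNIV"
proof -
  have "z \<in> D" for z
  proof -
    obtain J :: dquat where J: "J \<in> imag_units" using imag_unit_dquat_i by blast
    have "of_real (Re z) + Im z *\<^sub>R J \<in> Omega D"
      unfolding assms(2) using J by (auto simp: Q_DH_def)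
    then have *: "Complex (Re z) \<bar>Im z\<bar> \<in> D"
      using J by (simp add: Omega_iff[OF D] slice_coord_eq)
    then have "cnj (Complex (Re z) \<bar>Im z\<bar>) \<in> D" using D by blast
    then show "z \<in> D"
      using * by (cases "Im z \<ge> 0") (auto simp: complex_cnj complex.collapse)
  qed
  then show ?thesis by blast
qed

section \<open>The zero set\<close>

text \<open>Over a fixed \<open>z\<close> the function is affine in \<open>J\<close>, so its zeros
  are parametrised by the imaginary units solving one affine equation.\<close>

lemma zero_set_fibre:
  assumes F: "stem_function D F" and f: "\<And>x. x \<in> Omega D \<Longrightarrow> f x = slice_fun F x"
    and D: "cnj ` D = D" and z: "z \<in> D" "Im z \<ge> 0"
  shows "{x \<in> zero_set D f. slice_coord x = z}
    = (\<lambda>J. of_real (Re z) + Im z *\<^sub>R J) ` {J \<in> imag_units. fst (F z) + J * snd (F z) = 0}"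
proof -
  have val: "f (of_real (Re z) + Im z *\<^sub>R J) = fst (F z) + J * snd (F z)"
    and coord: "slice_coord (of_real (Re z) + Im z *\<^sub>R J) = z"
    and mem: "of_real (Re z) + Im z *\<^sub>R J \<in> Omega D"
    if J: "J \<in> imag_units" for J
  proof -
    show "slice_coord (of_real (Re z) + Im z *\<^sub>R J) = z"
      using z by (simp add: slice_coord_eq[OF J])
    have zD: "Complex (Re z) (Im z) \<in> D" using z(1) by simp
    show *: "of_real (Re z) + Im z *\<^sub>R J \<in> Omega D"
      unfolding circularization_def using J zD by blast
    show "f (of_real (Re z) + Im z *\<^sub>R J) = fst (F z) + J * snd (F z)"
      using slice_fun_eq[OF F, of "Re z" "Im z" J] J z(1) f[OF *] by simp
  qed
  show ?thesis
  proof (intro set_eqI iffI)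
    fix x assume "x \<in> {x \<in> zero_set D f. slice_coord x = z}"
    then have x: "x \<in> Omega D" "f x = 0" "slice_coord x = z" by (auto simp: zero_set_def)
    obtain J where "J \<in> imag_units" "x = of_real (Re z) + Im z *\<^sub>R J"
      using Q_DH_cases[of x] x Omega_iff[OF D] by metis
    with x val show "x \<in> (\<lambda>J. of_real (Re z) + Im z *\<^sub>R J) `
        {J \<in> imag_units. fst (F z) + J * snd (F z) = 0}" by auto
  next
    fix x assume "x \<in> (\<lambda>J. of_real (Re z) + Im z *\<^sub>R J) `
        {J \<in> imag_units. fst (F z) + J * snd (F z) = 0}"
    then show "x \<in> {x \<in> zero_set D f. slice_coord x = z}"
      using val coord mem by (auto simp: zero_set_def)
  qed
qed

text \<open>Transports the three cases of \<open>affine_imag_unit_solutions\<close> from imaginary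
  units to points through \<open>slice\<close>.\<close>

lemma zero_set_fibre_cases:
  assumes F: "stem_function D F" and f: "\<And>x. x \<in> Omega D \<Longrightarrow> f x = slice_fun F x"
    and D: "cnj ` D = D" and y: "y \<in> zero_set D f"
  defines "S \<equiv> {x \<in> zero_set D f. slice_coord x = slice_coord y}"
  shows "S = {y} \<or> (y \<notin> \<real> \<and> S = tangent_plane (primal y)) \<or> S = sphere_of y"
proof -
  define z where "z = slice_coord y"
  define slice where "slice J = of_real (Re z) + Im z *\<^sub>R J" for J :: dquat
  have yQ: "y \<in> Q_DH" and z: "z \<in> D" "Im z \<ge> 0"
    using y Omega_iff[OF D] by (auto simp: zero_set_def z_def slice_coord_def)
  have S: "S = slice ` {J \<in> imag_units. fst (F z) + J * snd (F z) = 0}"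
    unfolding S_def slice_def
    using zero_set_fibre[OF F f D z] by (simp add: z_def)
  have "y \<in> S" using y by (simp add: S_def)
  then obtain J where J: "J \<in> imag_units" "fst (F z) + J * snd (F z) = 0" and yJ: "y = slice J"
    using S by auto
  have sphere: "sphere_of y = slice ` imag_units"
  proof -
    have "x \<in> slice ` imag_units" if "x \<in> Q_DH" "slice_coord x = z" for x
      using Q_DH_cases[OF that(1)] that(2) by (metis slice_def imageI)
    moreover have "slice K \<in> Q_DH" "slice_coord (slice K) = z" if "K \<in> imag_units" for K
      using that z by (auto simp: slice_def slice_coord_eq Q_DH_def)
    ultimately show ?thesis unfolding sphere_of_eq[OF yQ] z_def[symmetric] by blast
  qed
  show ?thesis
  proof (cases "Im z = 0")
    \<comment> \<open>Over a real \<open>z\<close> the map \<open>slice\<close> is constant, so the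
      fibre is a single point.\<close>
    case True
    then have "S = {y}" using \<open>y \<in> S\<close> S yJ by (auto simp: slice_def)
    then show ?thesis by blast
  next
    case False
    have "y \<notin> \<real>"
    proof
      assume "y \<in> \<real>"
      then obtain r where "y = of_real r" by (auto elim: Reals_cases)
      then have "Im (slice_coord y) = 0"
        by (simp add: slice_coord_def Im_part_def of_real_def flip: zero_quat_def)
      with False show False by (simp add: z_def)
    qed
    moreover have "tangent_plane (primal y) = slice ` {K \<in> imag_units. primal K = primal J}"
      unfolding yJ slice_def tangent_plane_eq[OF J(1) False] by blast
    ultimately show ?thesis
      using affine_imag_unit_solutions[OF J] sphere yJ S by (elim disjE) simp_all
  qed
qed

theorem theorem7p3:
  fixes D :: "complex set"
    and F :: "complex \<Rightarrow> dquat \<times> dquat"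
    and f :: "dquat \<Rightarrow> dquat"
  assumes "slice_regular_by D F f"
    and "slice_domain D \<and> (\<exists>q\<in>quat_slice (Omega D). primal_part F q \<noteq> 0)
       \<or> product_domain D \<and> (\<exists>q\<in>quat_slice (Omega D). normal_primal_part F q \<noteq> 0)"
  shows "\<exists>\<C>.
      zero_set D f = \<Union>\<C> \<and>
      (\<forall>S\<in>\<C>. isolated_subset S (zero_set D f) \<and>
        (\<exists>y\<in>zero_set D f. S = {y} \<or> (y \<notin> \<real> \<and> S = tangent_plane (primal y)) \<or> S = sphere_of y)) \<and>
      ((\<exists>P :: dquat poly. Omega D = Q_DH \<and> (\<forall>x\<in>Q_DH. f x = eval_right P x)) \<longrightarrow> finite \<C>)"
proof -
  let ?V = "zero_set D f"
  define fibre where "fibre z = {x \<in> ?V. slice_coord x = z}" for z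
  \<comment> \<open>The pieces are indexed by the coordinates of zeros, so finitely many coordinates
    give finitely many pieces.\<close>
  define \<C> where "\<C> = fibre ` slice_coord ` ?V"
  have reg: "regular_stem D F" and f: "\<And>x. x \<in> Omega D \<Longrightarrow> f x = slice_fun F x"
    using assms(1) by (auto simp: slice_regular_by_def)
  have stem: "stem_function D F" using reg by (simp add: regular_stem_def)
  have dom: "slice_domain D \<or> product_domain D" using assms(2) by blast
  then have D: "cnj ` D = D" using product_domain_cnj by (auto simp: slice_domain_def)
  obtain w where w: "w \<in> D" "complex_normal F w \<noteq> 0"
    using complex_normal_nonzero[OF reg assms(2)] by blast
  have coord: "slice_coord x \<in> D" "complex_normal F (slice_coord x) = 0" if x: "x \<in> ?V" for x
  proof -
    show z: "slice_coord x \<in> D" using x Omega_iff[OF D] by (auto simp: zero_set_def)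
    have "x \<in> {x' \<in> ?V. slice_coord x' = slice_coord x}" using x by simp
    then obtain J where "J \<in> imag_units"
      "fst (F (slice_coord x)) + J * snd (F (slice_coord x)) = 0"
      using zero_set_fibre[OF stem f D z] by (auto simp: slice_coord_def)
    then show "complex_normal F (slice_coord x) = 0" by (rule complex_normal_zero)
  qed
  have isolated: "isolated_subset (fibre (slice_coord y)) ?V" if y: "y \<in> ?V" for y
  proof -
    obtain r where r: "r > 0"
      "\<And>u. u \<in> ball (slice_coord y) r \<Longrightarrow> u \<noteq> slice_coord y \<Longrightarrow> complex_normal F u \<noteq> 0"
      using complex_normal_zeros_isolated[OF reg dom w coord(1)[OF y]] by blast
    \<comment> \<open>The separating open set is the preimage of a disc in which
      \<open>complex_normal\<close> has no zero besides the centre.\<close>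
    have "open (slice_coord -` ball (slice_coord y) r)"
      using continuous_slice_coord by (intro open_vimage) auto
    moreover have "fibre (slice_coord y) \<subseteq> slice_coord -` ball (slice_coord y) r"
      using r(1) by (auto simp: fibre_def)
    moreover have "slice_coord -` ball (slice_coord y) r \<inter> (?V - fibre (slice_coord y)) = {}"
      using r(2) coord(2) unfolding fibre_def by blast
    ultimately show ?thesis
      unfolding isolated_subset_def by (metis (no_types, lifting) fibre_def mem_Collect_eq subsetI)
  qed
  have "?V = \<Union>\<C>" by (auto simp: \<C>_def fibre_def)
  moreover have "\<forall>S\<in>\<C>. isolated_subset S ?V \<and>
      (\<exists>y\<in>?V. S = {y} \<or> (y \<notin> \<real> \<and> S = tangent_plane (primal y)) \<or> S = sphere_of y)"
    using isolated zero_set_fibre_cases[OF stem f D] unfolding \<C>_def fibre_def by blast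
  moreover have "finite \<C>" if P: "Omega D = Q_DH" "\<forall>x\<in>Q_DH. f x = eval_right P x" for P
  proof -
    have "D = UNIV" using Omega_eq_Q_DH_D[OF D P(1)] .
    then have "finite {z. complex_normal F z = 0}"
      using complex_normal_polynomial_finite[of F P w] stem f P w by auto
    then have "finite (slice_coord ` ?V)"
      by (rule rev_finite_subset) (use coord(2) in auto)
    then show ?thesis by (simp add: \<C>_def)
  qed
  ultimately show ?thesis by (intro exI[of _ \<C>] conjI impI) (assumption | blast)+
qed

end
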